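(* Let $d\ge 1$ and let $V:\mathbb{R}^d\to\mathbb{R}$ be continuous, bounded and nonnegative. Let $u:\mathbb{R}^d\to\mathbb{C}$ be a solution of $\Delta u=Vu$ on $\mathbb{R}^d$. Assume that there exists a sequence $(r_j)_{j\ge 0}$ of real numbers increasing to $+\infty$ such that $$\int_{r_j\le |x|\le r_j+1}|u(x)|^2\,dx\to 0\quad\text{as } j\to+\infty .$$ Then $u\equiv 0$ on $\mathbb{R}^d$.
   Context: $\Delta=\sum_{i=1}^d\partial_{x_i}^2$ is the Laplacian on $\mathbb{R}^d$ and $|x|$ is the Euclidean norm. Solutions are understood to be of class $C^2(\mathbb{R}^d)$, with the equation holding pointwise. No decay or boundedness of $u$ is assumed beyond the stated condition along the sequence $(r_j)$. *)

theory Defs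
  imports "HOL-Analysis.Analysis"
begin

definition partial_deriv ::
    "'n::finite \<Rightarrow> (real ^ 'n \<Rightarrow> 'b::real_normed_vector) \<Rightarrow> real ^ 'n \<Rightarrow> 'b" where
  "partial_deriv i f x = vector_derivative (\<lambda>t. f (x + t *\<^sub>R axis i 1)) (at 0)"

(* vector_derivative is a choice operator, so existence of the partial derivatives
   has to be demanded separately from their continuity. *)
definition C1 :: "(real ^ 'n::finite \<Rightarrow> 'b::real_normed_vector) \<Rightarrow> bool" where
  "C1 f \<longleftrightarrow> continuous_on UNIV f \<and>
     (\<forall>i. (\<forall>x. (\<lambda>t. f (x + t *\<^sub>R axis i 1)) differentiable (at 0)) \<and>
          continuous_on UNIV (partial_deriv i f))"

definition C2 :: "(real ^ 'n::finite \<Rightarrow> 'b::real_normed_vector) \<Rightarrow> bool" where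
  "C2 f \<longleftrightarrow> C1 f \<and> (\<forall>i. C1 (partial_deriv i f))"

definition laplacian ::
    "(real ^ 'n::finite \<Rightarrow> 'b::real_normed_vector) \<Rightarrow> real ^ 'n \<Rightarrow> 'b" where
  "laplacian f x = (\<Sum>i\<in>UNIV. partial_deriv i (partial_deriv i f) x)"

end

(*
  Since V \<ge> 0, the function |u|^2 satisfies \<Delta>|u|^2 = 2 |\<nabla>u|^2 + 2 V |u|^2 \<ge> 2 |\<nabla>u|^2.
  Test this against a C^2 cutoff \<phi> that equals 1 on |x| \<le> r and 0 on |x| \<ge> r + 1 and whose
  Laplacian is bounded independently of r: then
  2 \<integral> \<phi> |\<nabla>u|^2 \<le> \<integral> |u|^2 \<Delta>\<phi> \<le> C \<integral>_{r \<le> |x| \<le> r+1} |u|^2, which tends to 0 along r = r_j.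
  Hence u is constant, and the constant vanishes because every shell contains a ball of
  radius 1/2.
*)

theory Submission
  imports Defs
begin

section \<open>Integrals of compactly supported directional derivatives\<close>

lemma integrable_continuous_bounded_support:
  fixes f :: "'a::euclidean_space \<Rightarrow> real"
  assumes "continuous_on UNIV f" and "\<And>x. norm x > R \<Longrightarrow> f x = 0"
  shows "integrable lborel f"
proof -
  have "integrable lborel (\<lambda>x. indicator (cball 0 R) x *\<^sub>R f x)"
    by (rule borel_integrable_compact) (auto intro: continuous_on_subset[OF assms(1)])
  also have "(\<lambda>x. indicator (cball 0 R) x *\<^sub>R f x) = f"
  proof
    show "indicator (cball 0 R) x *\<^sub>R f x = f x" for x
      using assms(2)[of x] by (cases "norm x \<le> R") auto
  qed
  finally show ?thesis .
qed

text \<open>The difference quotients of \<open>F\<close> have integral 0 by translation invariance, and they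
  converge dominatedly to \<open>G\<close>; this avoids Fubini.\<close>

lemma integral_line_derivative_eq_0:
  fixes F G :: "'a::euclidean_space \<Rightarrow> real" and e :: 'a
  assumes der: "\<And>x. ((\<lambda>t. F (x + t *\<^sub>R e)) has_real_derivative G x) (at 0)"
    and contF: "continuous_on UNIV F" and contG: "continuous_on UNIV G"
    and F0: "\<And>x. norm x > R \<Longrightarrow> F x = 0" and G0: "\<And>x. norm x > R \<Longrightarrow> G x = 0"
  shows "integral\<^sup>L lborel G = 0"
proof -
  have derl: "((\<lambda>t. F (x + t *\<^sub>R e)) has_real_derivative G (x + s *\<^sub>R e)) (at s)" for x s
    using der[of "x + s *\<^sub>R e"]
      DERIV_shift[of "\<lambda>t. F (x + t *\<^sub>R e)" _ 0 s]
    by (simp add: algebra_simps)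
  have "compact (G ` cball 0 R)"
    by (intro compact_continuous_image continuous_on_subset[OF contG]) auto
  then obtain M where M: "M > 0" "\<And>x. norm x \<le> R \<Longrightarrow> \<bar>G x\<bar> \<le> M"
    by (force dest!: compact_imp_bounded simp: bounded_pos)
  have GM: "\<bar>G x\<bar> \<le> M" for x
    using M G0[of x] by (cases "norm x \<le> R") auto
  have iF: "integrable lborel F"
    using integrable_continuous_bounded_support contF F0 by blast
  \<comment> \<open>Step sizes at most 1 keep all difference quotients supported in the single ball
    of radius \<open>R + norm e\<close>.\<close>
  define h where "h n = inverse (real (Suc n))" for n
  have h: "h n > 0" "h n \<le> 1" for n by (auto simp: h_def field_simps)
  define s where "s n x = (F (h n *\<^sub>R e + x) - F x) / h n" for n x
  have shift: "integrable lborel (\<lambda>x. F (c + x))"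
    "integral\<^sup>L lborel (\<lambda>x. F (c + x)) = integral\<^sup>L lborel F" for c
  proof -
    have Fb: "F \<in> borel_measurable borel"
      using contF by (simp add: borel_measurable_continuous_onI)
    show "integrable lborel (\<lambda>x. F (c + x))"
      using integrable_distr_eq[of "(+) c" lborel borel F] Fb iF
      by (simp add: lborel_distr_plus)
    show "integral\<^sup>L lborel (\<lambda>x. F (c + x)) = integral\<^sup>L lborel F"
      using integral_distr[of "(+) c" lborel borel F] Fb
      by (simp add: lborel_distr_plus)
  qed
  have s0: "integral\<^sup>L lborel (s n) = 0" for n
    unfolding s_def using shift iF by simp
  have "(\<lambda>n. integral\<^sup>L lborel (s n)) \<longlonglongrightarrow> integral\<^sup>L lborel G"
  proof (rule integral_dominated_convergence)
    show "integrable lborel (\<lambda>x. indicator (cball 0 (R + norm e)) x *\<^sub>R M)"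
      by (rule borel_integrable_compact) auto
    show "G \<in> borel_measurable lborel"
      using contG by (simp add: borel_measurable_continuous_onI)
    show "s n \<in> borel_measurable lborel" for n
      unfolding s_def using shift(1) iF by (intro borel_measurable_integrable) simp
    show "AE x in lborel. (\<lambda>n. s n x) \<longlonglongrightarrow> G x"
    proof (rule AE_I2)
      fix x
      have "((\<lambda>t. (F (x + t *\<^sub>R e) - F x) / t) \<longlongrightarrow> G x) (at 0)"
        using der[of x] by (simp add: DERIV_def)
      moreover have "filterlim h (at 0) sequentially"
        unfolding filterlim_at using h(1) LIMSEQ_inverse_real_of_nat
        by (simp add: h_def[abs_def] less_imp_neq[symmetric])
      ultimately show "(\<lambda>n. s n x) \<longlonglongrightarrow> G x"
        unfolding s_def using filterlim_compose by (fastforce simp: add.commute)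
    qed
    show "AE x in lborel. norm (s n x) \<le> indicator (cball 0 (R + norm e)) x *\<^sub>R M" for n
    proof (rule AE_I2)
      fix x
      show "norm (s n x) \<le> indicator (cball 0 (R + norm e)) x *\<^sub>R M"
      proof (cases "norm x \<le> R + norm e")
        case True
        \<comment> \<open>By the mean value theorem the quotient is itself a value of
          \<open>G\<close>, so the bound \<open>M\<close> serves for every n.\<close>
        obtain z where "F (x + h n *\<^sub>R e) - F (x + 0 *\<^sub>R e) = (h n - 0) * G (x + z *\<^sub>R e)"
          using MVT2[OF h(1)[of n], of "\<lambda>t. F (x + t *\<^sub>R e)" "\<lambda>t. G (x + t *\<^sub>R e)"] derl
          by blast
        then have "s n x = G (x + z *\<^sub>R e)"
          using h(1)[of n] by (simp add: s_def add.commute)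
        then show ?thesis using True GM by simp
      next
        case False
        have "norm (h n *\<^sub>R e) \<le> norm e"
          using h[of n] by (simp add: mult_left_le_one_le)
        then have "norm (h n *\<^sub>R e + x) > R" "norm x > R"
          using False norm_diff_ineq[of x "h n *\<^sub>R e"] norm_ge_zero[of e]
          by (auto simp: add.commute simp del: norm_ge_zero norm_scaleR)
        then show ?thesis using False F0 by (simp add: s_def)
      qed
    qed
  qed
  then show ?thesis
    using s0 by (simp add: LIMSEQ_const_iff)
qed

section \<open>A twice continuously differentiable cutoff on the line\<close>

abbreviation clamp01 :: "real \<Rightarrow> real" where "clamp01 s \<equiv> max 0 (min 1 s)"

text \<open>The kinks of \<open>clamp01\<close> do no harm: at the endpoints \<open>q\<close> has
  increments of order o(|z - c|), and \<open>clamp01\<close> is 1-Lipschitz.\<close>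

lemma DERIV_clamp01:
  fixes q :: "real \<Rightarrow> real"
  assumes der: "\<And>t. (q has_real_derivative q' t) (at t)" and "q' 0 = 0" "q' 1 = 0"
  shows "((\<lambda>s. q (clamp01 s)) has_real_derivative q' (clamp01 s)) (at s)"
proof (cases "0 < s \<and> s < 1")
  case True
  have "\<forall>\<^sub>F y in nhds s. q (clamp01 y) = q y"
    using True eventually_nhds_in_open[of "{0<..<1}" s]
    by (auto elim!: eventually_mono)
  then show ?thesis
    using True der[of s] by (subst DERIV_cong_ev[of _ s _ q]) auto
next
  case False
  then have q0: "q' (clamp01 s) = 0" using assms by (auto simp: max_def min_def)
  \<comment> \<open>Caratheodory's form of differentiability: the slope function \<open>g\<close> is
    continuous at the clamped point and takes there the value of \<open>q'\<close>, which is
    0.\<close>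
  obtain g where g: "\<And>z. q z - q (clamp01 s) = g z * (z - clamp01 s)"
      "isCont g (clamp01 s)" "g (clamp01 s) = 0"
    using der[of "clamp01 s"] q0 CARAT_DERIV by metis
  have "((\<lambda>y. g (clamp01 y)) \<longlongrightarrow> g (clamp01 s)) (at s)"
    by (rule isCont_tendsto_compose[OF g(2)]) (intro tendsto_intros)
  then have g0: "((\<lambda>y. g (clamp01 y)) \<longlongrightarrow> 0) (at s)" using g(3) by simp
  have "((\<lambda>y. (q (clamp01 y) - q (clamp01 s)) / (y - s)) \<longlongrightarrow> 0) (at s)"
  proof (rule Lim_null_comparison[OF _ tendsto_norm_zero[OF g0]], rule always_eventually, rule allI)
    fix y
    \<comment> \<open>For y = s the quotients are 0 by the convention x / 0 = 0, so the comparison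
      holds for every y.\<close>
    have "\<bar>clamp01 y - clamp01 s\<bar> \<le> \<bar>y - s\<bar>" by (auto simp: max_def min_def)
    then have "\<bar>clamp01 y - clamp01 s\<bar> / \<bar>y - s\<bar> \<le> 1" by (simp add: divide_le_eq_1)
    then have "\<bar>g (clamp01 y)\<bar> * (\<bar>clamp01 y - clamp01 s\<bar> / \<bar>y - s\<bar>) \<le> \<bar>g (clamp01 y)\<bar>"
      by (intro mult_left_le) auto
    then show "norm ((q (clamp01 y) - q (clamp01 s)) / (y - s)) \<le> norm (g (clamp01 y))"
      by (simp add: g(1) abs_mult)
  qed
  then show ?thesis using q0 by (simp add: has_field_derivative_iff)
qed

text \<open>The degree-5 polynomial below is 1 at 0 and 0 at 1, with vanishing first and second
  derivatives at both points. The argument $(|x|^2 - r^2)/(2r+1)$ used below runs from 0 to 1 across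
  the shell and, unlike $|x| - r$, is smooth at the origin.\<close>

definition cutoff :: "real \<Rightarrow> real" where
  "cutoff s = (let t = clamp01 s in 1 - 10 * t^3 + 15 * t^4 - 6 * t^5)"

definition cutoff' :: "real \<Rightarrow> real" where
  "cutoff' s = (let t = clamp01 s in - 30 * t^2 + 60 * t^3 - 30 * t^4)"

definition cutoff'' :: "real \<Rightarrow> real" where
  "cutoff'' s = (let t = clamp01 s in - 60 * t + 180 * t^2 - 120 * t^3)"

lemma DERIV_cutoff: "(cutoff has_real_derivative cutoff' s) (at s)"
  unfolding cutoff_def[abs_def] cutoff'_def Let_def
  by (rule DERIV_clamp01) (auto intro!: derivative_eq_intros)

lemma DERIV_cutoff': "(cutoff' has_real_derivative cutoff'' s) (at s)"
  unfolding cutoff'_def[abs_def] cutoff''_def Let_def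
  by (rule DERIV_clamp01) (auto intro!: derivative_eq_intros)

lemma continuous_on_cutoff [continuous_intros]:
  assumes "continuous_on S f"
  shows "continuous_on S (\<lambda>x. cutoff (f x))" "continuous_on S (\<lambda>x. cutoff' (f x))"
    "continuous_on S (\<lambda>x. cutoff'' (f x))"
  unfolding cutoff_def cutoff'_def cutoff''_def Let_def
  by (intro continuous_intros assms)+

lemma cutoff_constant:
  "s \<ge> 1 \<Longrightarrow> cutoff s = 0"
  "s \<le> 0 \<or> s \<ge> 1 \<Longrightarrow> cutoff' s = 0" "s \<le> 0 \<or> s \<ge> 1 \<Longrightarrow> cutoff'' s = 0"
  "s \<le> 0 \<Longrightarrow> cutoff s = 1"
  by (auto simp: cutoff_def cutoff'_def cutoff''_def)

lemma cutoff_nonneg: "cutoff s \<ge> 0"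
proof -
  define t where "t = clamp01 s"
  have t: "0 \<le> t" "t \<le> 1" by (auto simp: t_def)
  \<comment> \<open>The polynomial and its first two derivatives vanish at 1, hence the cubic
    factor; the cofactor has positive coefficients.\<close>
  have "cutoff s = (1 - t)^3 * (1 + 3 * t + 6 * t^2)"
    unfolding cutoff_def t_def[symmetric] Let_def
    by (simp add: algebra_simps power2_eq_square power3_eq_cube eval_nat_numeral)
  then show ?thesis using t by simp
qed

text \<open>All powers of the clamped argument lie in [0, 1], so the sums of the absolute values of
  the coefficients serve as bounds.\<close>

lemma abs_cutoff_derivs_le: "\<bar>cutoff' s\<bar> \<le> 120" "\<bar>cutoff'' s\<bar> \<le> 360"
proof -
  define t where "t = clamp01 s"
  have "0 \<le> t" "t \<le> 1" by (auto simp: t_def)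
  then have "0 \<le> t^2" "t^2 \<le> 1" "0 \<le> t^3" "t^3 \<le> 1" "0 \<le> t^4" "t^4 \<le> 1" "0 \<le> t" "t \<le> 1"
    by (auto simp: power_le_one)
  then show "\<bar>cutoff' s\<bar> \<le> 120" "\<bar>cutoff'' s\<bar> \<le> 360"
    unfolding cutoff'_def cutoff''_def t_def[symmetric] Let_def by linarith+
qed

section \<open>Partial derivatives and constancy\<close>

lemma C1_line_derivative:
  assumes "C1 f"
  shows "((\<lambda>t. f (x + t *\<^sub>R axis i 1)) has_vector_derivative partial_deriv i f x) (at 0)"
  using assms by (simp add: C1_def partial_deriv_def vector_derivative_works)

text \<open>\<open>f\<close> is constant on every line parallel to an axis, and 0 is joined to x by
  changing one coordinate at a time.\<close>

lemma C1_partial_derivs_0_imp_constant: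
  fixes f :: "real ^ 'n::finite \<Rightarrow> 'b::real_normed_vector"
  assumes "C1 f" and "\<And>i x. partial_deriv i f x = 0"
  shows "f x = f 0"
proof -
  have line: "f (x + t *\<^sub>R axis i 1) = f x" for x i t
  proof -
    have "((\<lambda>t. f (x + t *\<^sub>R axis i 1)) has_vector_derivative 0) (at s)" for s
    proof -
      \<comment> \<open>Partial derivatives speak only of parameter 0; moving the base point and
        composing with the shift t - s gives the derivative at every s.\<close>
      have "((\<lambda>t. f ((x + s *\<^sub>R axis i 1) + t *\<^sub>R axis i 1)) has_vector_derivative 0) (at (s - s))"
        using C1_line_derivative[OF assms(1), of "x + s *\<^sub>R axis i 1" i] assms(2) by simp
      moreover have "((\<lambda>t. t - s) has_vector_derivative 1) (at s)"
        by (auto intro!: derivative_eq_intros)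
      ultimately have "((\<lambda>t. f ((x + s *\<^sub>R axis i 1) + t *\<^sub>R axis i 1)) \<circ> (\<lambda>t. t - s)
          has_vector_derivative 1 *\<^sub>R 0) (at s)"
        by (rule vector_diff_chain_at[rotated])
      then show ?thesis by (simp add: o_def algebra_simps)
    qed
    then have "(\<lambda>t. f (x + t *\<^sub>R axis i 1)) t = (\<lambda>t. f (x + t *\<^sub>R axis i 1)) 0"
      by (intro has_derivative_zero_unique[of UNIV, simplified])
         (auto simp: has_vector_derivative_def)
    then show ?thesis by simp
  qed
  have "f (\<Sum>i\<in>I. (x $ i) *\<^sub>R axis i 1) = f 0" if "finite I" for I
    using that by (induction I) (auto simp: line add.commute[of "_ *\<^sub>R _"])
  from this[of UNIV] show ?thesis
    by (simp add: basis_expansion flip: scalar_mult_eq_scaleR)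
qed

section \<open>The radial cutoff and Green's identity in one direction\<close>

lemma line_derivative_cutoff:
  fixes x :: "real ^ 'n::finite"
  shows "((\<lambda>t. cutoff (((norm (x + t *\<^sub>R axis i 1))\<^sup>2 - r\<^sup>2) / (2 * r + 1)))
          has_real_derivative 2 * x $ i / (2 * r + 1) * cutoff' (((norm x)\<^sup>2 - r\<^sup>2) / (2 * r + 1))) (at 0)" (is ?A)
    and "((\<lambda>t. 2 * (x + t *\<^sub>R axis i 1) $ i / (2 * r + 1)
            * cutoff' (((norm (x + t *\<^sub>R axis i 1))\<^sup>2 - r\<^sup>2) / (2 * r + 1)))
          has_real_derivative 2 / (2 * r + 1) * cutoff' (((norm x)\<^sup>2 - r\<^sup>2) / (2 * r + 1))
            + (2 * x $ i / (2 * r + 1))\<^sup>2 * cutoff'' (((norm x)\<^sup>2 - r\<^sup>2) / (2 * r + 1))) (at 0)" (is ?B)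
proof -
  \<comment> \<open>Along an axis the squared norm is a quadratic polynomial in t, so the chain rule
    becomes one-dimensional.\<close>
  have nrm: "(norm (x + t *\<^sub>R axis i 1))\<^sup>2 = (norm x)\<^sup>2 + 2 * t * x $ i + t\<^sup>2" for t
    unfolding power2_norm_eq_inner
    by (simp add: inner_simps inner_axis inner_axis' inner_commute power2_eq_square algebra_simps)
  have arg: "((\<lambda>t. ((norm (x + t *\<^sub>R axis i 1))\<^sup>2 - r\<^sup>2) / (2 * r + 1))
      has_real_derivative 2 * x $ i / (2 * r + 1)) (at 0)"
    unfolding nrm by (auto intro!: derivative_eq_intros simp: divide_inverse)
  show ?A
    using DERIV_chain2[OF DERIV_cutoff arg] by (simp add: mult.commute)
  have co: "((\<lambda>t. 2 * (x + t *\<^sub>R axis i 1) $ i / (2 * r + 1)) has_real_derivative 2 / (2 * r + 1)) (at 0)"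
    by (auto intro!: derivative_eq_intros simp: divide_inverse)
  show ?B
    using DERIV_mult[OF co DERIV_chain2[OF DERIV_cutoff' arg]]
    by (simp add: power2_eq_square algebra_simps)
qed

text \<open>The denominator is (r + 1)^2 - r^2.\<close>

lemma cutoff_arg:
  fixes x :: "'a::real_normed_vector"
  assumes "r \<ge> 0"
  shows "norm x \<le> r \<Longrightarrow> ((norm x)\<^sup>2 - r\<^sup>2) / (2 * r + 1) \<le> 0"
    and "norm x \<ge> r + 1 \<Longrightarrow> ((norm x)\<^sup>2 - r\<^sup>2) / (2 * r + 1) \<ge> 1"
proof -
  show "((norm x)\<^sup>2 - r\<^sup>2) / (2 * r + 1) \<le> 0" if "norm x \<le> r"
    using that assms power_mono[OF that, of 2] by (auto simp: divide_le_0_iff)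
  show "((norm x)\<^sup>2 - r\<^sup>2) / (2 * r + 1) \<ge> 1" if "norm x \<ge> r + 1"
    using assms power_mono[OF that, of 2] by (auto simp: le_divide_eq power2_sum)
qed

lemma C1_inner_line_derivative:
  fixes f g :: "real ^ 'n::finite \<Rightarrow> 'b::real_inner"
  assumes "C1 f" "C1 g"
  shows "((\<lambda>t. f (x + t *\<^sub>R axis i 1) \<bullet> g (x + t *\<^sub>R axis i 1)) has_real_derivative
          f x \<bullet> partial_deriv i g x + partial_deriv i f x \<bullet> g x) (at 0)"
  using bounded_bilinear.has_vector_derivative[OF bounded_bilinear_inner
      C1_line_derivative[OF assms(1)] C1_line_derivative[OF assms(2)]]
  by (simp add: has_real_derivative_iff_has_vector_derivative)

text \<open>This moves two derivatives in direction i from |u|^2 onto the cutoff: \<open>P\<close>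
  is the cutoff times the second partial of |u|^2, and \<open>D\<close> is |u|^2 times the second
  partial of the cutoff.\<close>

lemma integral_cutoff_second_partial:
  fixes u :: "real ^ 'n::finite \<Rightarrow> 'b::real_inner" and r :: real and i :: 'n
  assumes u: "C2 u" and r: "r \<ge> 0"
  defines "a \<equiv> (\<lambda>x::real^'n. ((norm x)\<^sup>2 - r\<^sup>2) / (2 * r + 1))"
  defines "P \<equiv> (\<lambda>x. cutoff (a x) * (2 * (norm (partial_deriv i u x))\<^sup>2
                       + 2 * (u x \<bullet> partial_deriv i (partial_deriv i u) x)))"
  defines "D \<equiv> (\<lambda>x. (norm (u x))\<^sup>2 * (2 / (2 * r + 1) * cutoff' (a x)
                       + (2 * x $ i / (2 * r + 1))\<^sup>2 * cutoff'' (a x)))"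
  shows "integrable lborel P" "integrable lborel D" "integral\<^sup>L lborel P = integral\<^sup>L lborel D"
proof -
  have C1u: "C1 u" "C1 (partial_deriv i u)" using u by (auto simp: C2_def)
  then have cont: "continuous_on UNIV u" "continuous_on UNIV (partial_deriv i u)"
      "continuous_on UNIV (partial_deriv i (partial_deriv i u))"
    by (auto simp: C1_def)
  have conta: "continuous_on UNIV a"
    unfolding a_def using r by (intro continuous_intros) auto
  have a1: "a x \<ge> 1" if "norm x > r + 1" for x
    using cutoff_arg(2)[OF r, of x] that by (auto simp: a_def)
  have contP: "continuous_on UNIV P" and contD: "continuous_on UNIV D"
    unfolding P_def D_def using r by (intro continuous_intros cont conta; simp)+
  have P0: "P x = 0" and D0: "D x = 0" if "norm x > r + 1" for x
    using a1[OF that] by (auto simp: P_def D_def cutoff_constant)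
  show iP: "integrable lborel P" and iD: "integrable lborel D"
    using integrable_continuous_bounded_support contP contD P0 D0 by blast+
  \<comment> \<open>Green's identity for $\varphi$ and $w = |u|^2$: $F = \varphi\,\partial_i w - w\,\partial_i\varphi$,
    whose $i$-th derivative is $P - D$\<close>
  define F where "F = (\<lambda>x. cutoff (a x) * (2 * (u x \<bullet> partial_deriv i u x))
                        - (u x \<bullet> u x) * (2 * x $ i / (2 * r + 1) * cutoff' (a x)))"
  have "integral\<^sup>L lborel (\<lambda>x. P x - D x) = 0"
  proof (rule integral_line_derivative_eq_0)
    show "continuous_on UNIV F"
      unfolding F_def using r by (intro continuous_intros cont conta) simp
    show "continuous_on UNIV (\<lambda>x. P x - D x)" by (intro continuous_intros contP contD)
    show "F x = 0" "P x - D x = 0" if "norm x > r + 1" for x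
      using a1[OF that] P0[OF that] D0[OF that] by (auto simp: F_def cutoff_constant)
    show "((\<lambda>t. F (x + t *\<^sub>R axis i 1)) has_real_derivative P x - D x) (at 0)" for x
      \<comment> \<open>The two products of first derivatives of |u|^2 and of the cutoff
        cancel.\<close>
      unfolding F_def a_def
      by (rule DERIV_cong[OF DERIV_diff[OF
            DERIV_mult[OF line_derivative_cutoff(1) DERIV_cmult[OF C1_inner_line_derivative[OF C1u]]]
            DERIV_mult[OF C1_inner_line_derivative[OF C1u(1) C1u(1)] line_derivative_cutoff(2)]]])
         (simp add: P_def D_def a_def power2_norm_eq_inner inner_commute algebra_simps)
  qed
  then show "integral\<^sup>L lborel P = integral\<^sup>L lborel D"
    using iP iD by simp
qed

section \<open>The energy estimate by the mass on a shell\<close>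

lemma set_integrable_shell:
  fixes f :: "'a::euclidean_space \<Rightarrow> real"
  assumes "continuous_on UNIV f"
  shows "set_integrable lborel {x. a \<le> norm x \<and> norm x \<le> b} f"
proof -
  have "{x::'a. a \<le> norm x \<and> norm x \<le> b} = cball 0 b \<inter> (norm -` {a..})" by auto
  also have "compact \<dots>"
    by (intro compact_Int_closed closed_vimage) (auto intro: continuous_intros)
  finally show ?thesis
    unfolding set_integrable_def
    by (intro borel_integrable_compact continuous_on_subset[OF assms]) auto
qed

text \<open>Summing Green's identity over all directions brings in the Laplacian of |u|^2, which the
  equation and \<open>V x \<ge> 0\<close> keep nonnegative. The constant depends neither on r nor on
  the box, so r can grow while the box stays fixed.\<close>

lemma caccioppoli_shell:
  fixes u :: "real ^ 'n::finite \<Rightarrow> 'b::real_inner" and V :: "real ^ 'n \<Rightarrow> real"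
  assumes u: "C2 u" and eq: "\<And>x. laplacian u x = V x *\<^sub>R u x" and V: "\<And>x. V x \<ge> 0"
    and r: "r \<ge> 0" "cball 0 r \<supseteq> cbox a b"
  shows "set_lebesgue_integral lborel (cbox a b) (\<lambda>x. \<Sum>i\<in>UNIV. (norm (partial_deriv i u x))\<^sup>2)
    \<le> 840 * CARD('n) * set_lebesgue_integral lborel {x. r \<le> norm x \<and> norm x \<le> r + 1} (\<lambda>x. (norm (u x))\<^sup>2)"
    (is "?L \<le> _ * ?S")
proof -
  define g where "g = (\<lambda>x::real^'n. ((norm x)\<^sup>2 - r\<^sup>2) / (2 * r + 1))"
  define P where "P = (\<lambda>i x. cutoff (g x) * (2 * (norm (partial_deriv i u x))\<^sup>2
                       + 2 * (u x \<bullet> partial_deriv i (partial_deriv i u) x)))"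
  define D where "D = (\<lambda>i x. (norm (u x))\<^sup>2 * (2 / (2 * r + 1) * cutoff' (g x)
                       + (2 * x $ i / (2 * r + 1))\<^sup>2 * cutoff'' (g x)))"
  define E where "E = (\<lambda>x. \<Sum>i\<in>UNIV. (norm (partial_deriv i u x))\<^sup>2)"
  have PD: "integrable lborel (P i)" "integrable lborel (D i)"
      "integral\<^sup>L lborel (P i) = integral\<^sup>L lborel (D i)" for i
    unfolding P_def D_def g_def by (rule integral_cutoff_second_partial[OF u r(1)])+
  have contu: "continuous_on UNIV u" and cpu: "\<And>i. continuous_on UNIV (partial_deriv i u)"
    using u by (auto simp: C2_def C1_def)
  have contE: "continuous_on UNIV E" unfolding E_def by (intro continuous_intros cpu)
  have sumP: "(\<Sum>i\<in>UNIV. P i x) = cutoff (g x) * (2 * E x + 2 * V x * (norm (u x))\<^sup>2)" for x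
  proof -
    have "u x \<bullet> (\<Sum>i\<in>UNIV. partial_deriv i (partial_deriv i u) x) = V x * (norm (u x))\<^sup>2"
      using eq[of x] by (simp add: laplacian_def power2_norm_eq_inner)
    moreover have "(\<Sum>i\<in>UNIV. P i x) = cutoff (g x) * (2 * E x
        + 2 * (u x \<bullet> (\<Sum>i\<in>UNIV. partial_deriv i (partial_deriv i u) x)))"
      by (simp add: P_def E_def inner_sum_right sum_distrib_left sum.distrib distrib_left)
    ultimately show ?thesis by simp
  qed
  have E0: "E x \<ge> 0" for x by (auto simp: E_def intro: sum_nonneg)
  \<comment> \<open>Off the open shell both derivatives of the cutoff vanish. On the shell, r \<ge>
    0 bounds 2 / (2r + 1) and 2(r + 1) / (2r + 1) by 2, and 1680 = 2 * 120 + 4 * 360.\<close>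
  have D_le: "D i x \<le> indicator {x. r \<le> norm x \<and> norm x \<le> r + 1} x *\<^sub>R (1680 * (norm (u x))\<^sup>2)" for i x
  proof (cases "r \<le> norm x \<and> norm x \<le> r + 1")
    case True
    have A: "\<bar>2 / (2 * r + 1) * cutoff' (g x)\<bar> \<le> 2 * 120"
      unfolding abs_mult using r abs_cutoff_derivs_le(1)
      by (intro mult_mono) (auto simp: divide_le_eq)
    have B: "\<bar>(2 * x $ i / (2 * r + 1))\<^sup>2 * cutoff'' (g x)\<bar> \<le> 2\<^sup>2 * 360"
    proof -
      have "\<bar>x $ i\<bar> \<le> r + 1" using True component_le_norm_cart[of x i] by simp
      then have "\<bar>2 * x $ i / (2 * r + 1)\<bar> \<le> 2" using r by (simp add: abs_mult divide_le_eq)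
      then have "(2 * x $ i / (2 * r + 1))\<^sup>2 \<le> 2\<^sup>2"
        by (metis abs_le_square_iff abs_numeral)
      then show ?thesis
        unfolding abs_mult using abs_cutoff_derivs_le(2) by (intro mult_mono) auto
    qed
    have "2 / (2 * r + 1) * cutoff' (g x) + (2 * x $ i / (2 * r + 1))\<^sup>2 * cutoff'' (g x)
        \<le> 2 * 120 + 2\<^sup>2 * 360"
      by (rule add_mono[OF abs_le_D1[OF A] abs_le_D1[OF B]])
    then have "D i x \<le> (norm (u x))\<^sup>2 * (2 * 120 + 2\<^sup>2 * 360)"
      unfolding D_def by (intro mult_left_mono) auto
    then show ?thesis using True by simp
  next
    case False
    then have "g x \<le> 0 \<or> g x \<ge> 1"
      using cutoff_arg[OF r(1), of x] by (auto simp: g_def)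
    then show ?thesis using False by (simp add: D_def cutoff_constant)
  qed
  have shell: "set_integrable lborel {x. r \<le> norm x \<and> norm x \<le> r + 1} (\<lambda>x. 1680 * (norm (u x))\<^sup>2)"
    by (intro set_integrable_shell continuous_intros contu)
  have "2 * ?L = integral\<^sup>L lborel (\<lambda>x. indicator (cbox a b) x *\<^sub>R (2 * E x))"
    by (simp add: set_lebesgue_integral_def E_def mult.left_commute)
  \<comment> \<open>On the box the cutoff is 1 and the term with \<open>V\<close> is dropped;
    elsewhere the right integrand is nonnegative.\<close>
  also have "\<dots> \<le> integral\<^sup>L lborel (\<lambda>x. \<Sum>i\<in>UNIV. P i x)"
  proof (rule integral_mono)
    show "integrable lborel (\<lambda>x. indicator (cbox a b) x *\<^sub>R (2 * E x))"
      by (intro borel_integrable_compact compact_cbox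
            continuous_on_subset[OF continuous_on_mult_left[OF contE] subset_UNIV])
    show "integrable lborel (\<lambda>x. \<Sum>i\<in>UNIV. P i x)" using PD(1) by simp
    fix x
    show "indicator (cbox a b) x *\<^sub>R (2 * E x) \<le> (\<Sum>i\<in>UNIV. P i x)"
    proof (cases "x \<in> cbox a b")
      case True
      then have "g x \<le> 0" using r cutoff_arg(1)[OF r(1), of x] by (auto simp: g_def)
      then show ?thesis using True V[of x] by (simp add: sumP cutoff_constant)
    next
      case False
      then show ?thesis using V[of x] E0[of x] cutoff_nonneg[of "g x"] by (simp add: sumP)
    qed
  qed
  also have "\<dots> = (\<Sum>i\<in>UNIV. integral\<^sup>L lborel (D i))"
    using PD by simp
  \<comment> \<open>One copy of 1680 per direction, halved because the chain starts from
    \<open>2 * ?L\<close>, gives \<open>840 * CARD('n)\<close>.\<close>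
  also have "\<dots> \<le> (\<Sum>i\<in>(UNIV::'n set). 1680 * ?S)"
  proof (rule sum_mono)
    fix i
    have "integral\<^sup>L lborel (D i) \<le> set_lebesgue_integral lborel {x. r \<le> norm x \<and> norm x \<le> r + 1}
        (\<lambda>x. 1680 * (norm (u x))\<^sup>2)"
      unfolding set_lebesgue_integral_def
      using PD(2) shell D_le by (intro integral_mono) (auto simp: set_integrable_def)
    then show "integral\<^sup>L lborel (D i) \<le> 1680 * ?S" by simp
  qed
  finally show ?thesis by simp
qed

section \<open>Vanishing of the gradient, then of the constant\<close>

theorem theorem2p1:
  fixes V :: "real ^ 'n::finite \<Rightarrow> real"
    and u :: "real ^ 'n \<Rightarrow> complex"
    and r :: "nat \<Rightarrow> real"
  assumes "continuous_on UNIV V"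
    and "bounded (range V)"
    and "\<And>x. V x \<ge> 0"
    and "C2 u"
    and "\<And>x. laplacian u x = complex_of_real (V x) * u x"
    and "incseq r"
    and "filterlim r at_top sequentially"
    and "(\<lambda>j. set_lebesgue_integral lborel {x. r j \<le> norm x \<and> norm x \<le> r j + 1}
                (\<lambda>x. (norm (u x))\<^sup>2)) \<longlonglongrightarrow> 0"
  shows "\<forall>x. u x = 0"
proof -
  have r_top: "\<forall>\<^sub>F j in sequentially. R \<le> r j" for R
    using assms(7) by (simp add: filterlim_at_top)
  define S where "S j = set_lebesgue_integral lborel {x. r j \<le> norm x \<and> norm x \<le> r j + 1}
                (\<lambda>x. (norm (u x))\<^sup>2)" for j
  have S: "S \<longlonglongrightarrow> 0" using assms(8) by (simp add: S_def[abs_def])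
  define E where "E = (\<lambda>x. \<Sum>i\<in>UNIV. (norm (partial_deriv i u x))\<^sup>2)"
  have E0: "E x \<ge> 0" for x by (auto simp: E_def intro: sum_nonneg)
  have C1u: "C1 u" using assms(4) by (simp add: C2_def)
  then have contE: "continuous_on UNIV E"
    unfolding E_def by (intro continuous_intros) (auto simp: C1_def)
  have "E x = 0" for x
  proof -
    define a b where "a = x - One" and "b = x + One"
    have x: "x \<in> box a b" by (simp add: a_def b_def mem_box inner_simps)
    obtain R where R: "cbox a b \<subseteq> cball 0 R"
      using bounded_cbox[of a b] by (auto simp: bounded_iff subset_eq)
    have int: "set_integrable lborel (cbox a b) E"
      unfolding set_integrable_def
      by (intro borel_integrable_compact continuous_on_subset[OF contE]) auto
    have "set_lebesgue_integral lborel (cbox a b) E \<le> 0"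
    proof (rule tendsto_lowerbound)
      show "(\<lambda>j. 840 * CARD('n) * S j) \<longlonglongrightarrow> 0"
        using tendsto_mult_left[OF S, of "840 * CARD('n)"] by simp
      show "\<forall>\<^sub>F j in sequentially.
          set_lebesgue_integral lborel (cbox a b) E \<le> 840 * CARD('n) * S j"
        \<comment> \<open>The maximum ensures both that \<open>r j\<close> is nonnegative and that
          the ball of radius \<open>r j\<close> contains the box.\<close>
        using r_top[of "max 0 R"]
      proof eventually_elim
        case (elim j)
        then have "cbox a b \<subseteq> cball 0 (r j)" using R by force
        then show ?case
          unfolding E_def S_def using elim assms(3-5)
          by (intro caccioppoli_shell[of _ V]) (auto simp: scaleR_conv_of_real)
      qed
    qed simp
    moreover have "set_lebesgue_integral lborel (cbox a b) E \<ge> 0"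
      unfolding set_lebesgue_integral_def using E0 by (intro Bochner_Integration.integral_nonneg) simp
    \<comment> \<open>The passage to the gauge integral gives access to the fact that a continuous
      nonnegative function with integral 0 over a box vanishes on it.\<close>
    ultimately have "integral (cbox a b) E = 0"
      using set_borel_integral_eq_integral(2)[OF int] by simp
    then have "(E has_integral 0) (cbox a b)"
      using set_borel_integral_eq_integral(1)[OF int] by (simp add: has_integral_iff)
    then show "E x = 0"
      by (rule has_integral_0_cbox_imp_0[OF continuous_on_subset[OF contE subset_UNIV] E0])
         (use x box_subset_cbox in blast)+
  qed
  then have part0: "partial_deriv i u x = 0" for i x
    by (auto simp: E_def sum_nonneg_eq_0_iff)
  define c where "c = u 0"
  have const: "u x = c" for x
    unfolding c_def using part0 C1_partial_derivs_0_imp_constant[OF C1u] by blast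
  define m where "m = measure lborel (ball (0::real^'n) (1/2))"
  have m: "m > 0" by (simp add: m_def content_ball_pos)
  have "m * (norm c)\<^sup>2 \<le> 0"
  proof (rule tendsto_lowerbound[OF S])
    show "\<forall>\<^sub>F j in sequentially. m * (norm c)\<^sup>2 \<le> S j"
      using r_top[of 0]
    proof eventually_elim
      case (elim j)
      \<comment> \<open>A centre midway between the two spheres leaves room for radius 1/2; by
        translation invariance the ball has volume \<open>m\<close> for every j.\<close>
      obtain k :: "real^'n" where k: "norm k = r j + 1/2"
        using vector_choose_size[of "r j + 1/2"] elim by auto
      have sub: "ball k (1/2) \<subseteq> {x. r j \<le> norm x \<and> norm x \<le> r j + 1}"
      proof
        fix y assume "y \<in> ball k (1/2)"
        then have "norm (k - y) < 1/2" by (simp add: dist_norm)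
        then show "y \<in> {x. r j \<le> norm x \<and> norm x \<le> r j + 1}"
          using k norm_triangle_ineq2[of k y] norm_triangle_ineq2[of y k]
          by (simp add: norm_minus_commute)
      qed
      have "m * (norm c)\<^sup>2 = set_lebesgue_integral lborel (ball k (1/2)) (\<lambda>x. (norm (u x))\<^sup>2)"
        by (simp add: const m_def set_lebesgue_integral_def
            content_ball_conv_unit_ball[of "1/2"])
      also have "\<dots> \<le> S j"
        unfolding S_def set_lebesgue_integral_def
      proof (rule integral_mono)
        have contu: "continuous_on UNIV (\<lambda>x. (norm (u x))\<^sup>2)"
          using C1u by (intro continuous_intros) (simp add: C1_def)
        show shell: "integrable lborel (\<lambda>x. indicator {x. r j \<le> norm x \<and> norm x \<le> r j + 1} x
            *\<^sub>R (norm (u x))\<^sup>2)"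
          using set_integrable_shell[OF contu] by (simp add: set_integrable_def)
        show "integrable lborel (\<lambda>x. indicator (ball k (1/2)) x *\<^sub>R (norm (u x))\<^sup>2)"
          by (rule set_integrable_subset[unfolded set_integrable_def, OF shell _ sub]) simp
      qed (use sub in \<open>auto simp: indicator_def\<close>)
      finally show ?case .
    qed
  qed simp
  then have "c = 0" using m by (simp add: mult_le_0_iff)
  then show ?thesis using const by simp
qed

end
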